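(* Let $L$ be a loop with a subloop $N$ and a subgroup $H$ such that $N\cap H=\{1\}$ and the elements of $H$ associate with the elements of $N$. Suppose that $\phi_h(n)=h(nh^{-1})$ ($h\in H$, $n\in N$) defines a group homomorphism $\phi:H\to Sym(N)_1$, $h\mapsto \phi_h$. Then $NH=\{nh\mid n\in N,\ h\in H\}$, with the operation of $L$, is isomorphic to the loop $N\rtimes_\phi H$.
   Context: A loop is a non-empty set with a binary operation such that for all $a,b$ the equations $xa=b$ and $ax=b$ have unique solutions, and there is a two-sided identity $1$. A subloop is a non-empty subset that is a loop under the induced operation; a subgroup of a loop is a subloop that is a group. $Sym(N)_1$ is the stabilizer of $1\in N$ in the group $Sym(N)$ of permutations of $N$. "The elements of $H$ associate with the elements of $N$" means that for all $n_1,n_2\in N$ and $h_1,h_2\in H$ all bracketings of the product $n_1h_1n_2h_2$ agree: $$(n_1h_1)(n_2h_2)=n_1((h_1n_2)h_2)=n_1(h_1(n_2h_2))=((n_1h_1)n_2)h_2=(n_1(h_1n_2))h_2,$$ and $h(nh^{-1})=(hn)h^{-1}$ for all $n\in N$, $h\in H$. For a loop $N$, a group $H$ and a group homomorphism $\phi:H\to Sym(N)_1$, $N\rtimes_\phi H$ is the loop on $N\times H$ with operation $(n_1,h_1)(n_2,h_2)=(n_1\phi_{h_1}(n_2),h_1h_2)$. *)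

theory Defs
  imports "HOL-Algebra.Algebra"
begin

locale loop =
  fixes L :: "('a, 'm) monoid_scheme" (structure)
  assumes m_closed: "\<lbrakk>x \<in> carrier L; y \<in> carrier L\<rbrakk> \<Longrightarrow> x \<otimes> y \<in> carrier L"
    and one_closed: "\<one> \<in> carrier L"
    and l_one: "x \<in> carrier L \<Longrightarrow> \<one> \<otimes> x = x"
    and r_one: "x \<in> carrier L \<Longrightarrow> x \<otimes> \<one> = x"
    and left_solution: "\<lbrakk>a \<in> carrier L; b \<in> carrier L\<rbrakk> \<Longrightarrow> \<exists>!x. x \<in> carrier L \<and> x \<otimes> a = b"
    and right_solution: "\<lbrakk>a \<in> carrier L; b \<in> carrier L\<rbrakk> \<Longrightarrow> \<exists>!x. x \<in> carrier L \<and> a \<otimes> x = b"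

text \<open>A subloop is only required to have some identity of its own; that it is the identity of the
  ambient loop is a consequence (\<open>subloop_one\<close> below).\<close>

definition subloop :: "'a set \<Rightarrow> ('a, 'm) monoid_scheme \<Rightarrow> bool" where
  "subloop S L \<longleftrightarrow> S \<subseteq> carrier L \<and> S \<noteq> {} \<and> (\<exists>e. loop (L\<lparr>carrier := S, one := e\<rparr>))"

definition loop_subgroup :: "'a set \<Rightarrow> ('a, 'm) monoid_scheme \<Rightarrow> bool" where
  "loop_subgroup S L \<longleftrightarrow> subloop S L \<and> (\<exists>e. group (L\<lparr>carrier := S, one := e\<rparr>))"

text \<open>The group of permutations of \<open>A\<close> fixing \<open>a\<close>, with product \<open>(g f)(x) = g (f x)\<close>.\<close>

definition SymStab :: "'a set \<Rightarrow> 'a \<Rightarrow> ('a \<Rightarrow> 'a) monoid" where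
  "SymStab A a = (BijGroup A)\<lparr>carrier := stabilizer (BijGroup A) (\<lambda>f. f) a\<rparr>"

definition semidirect ::
    "('a, 'm) monoid_scheme \<Rightarrow> ('b, 'n) monoid_scheme \<Rightarrow> ('b \<Rightarrow> 'a \<Rightarrow> 'a) \<Rightarrow> ('a \<times> 'b) monoid" where
  "semidirect N H \<phi> =
    \<lparr>carrier = carrier N \<times> carrier H,
     monoid.mult = (\<lambda>(n\<^sub>1, h\<^sub>1) (n\<^sub>2, h\<^sub>2). (n\<^sub>1 \<otimes>\<^bsub>N\<^esub> \<phi> h\<^sub>1 n\<^sub>2, h\<^sub>1 \<otimes>\<^bsub>H\<^esub> h\<^sub>2)),
     one = (\<one>\<^bsub>N\<^esub>, \<one>\<^bsub>H\<^esub>)\<rparr>"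

text \<open>In a loop inverses need not exist; \<open>inv h\<close> is the inverse in the group \<open>H\<close>.\<close>

definition associates_with :: "('a, 'm) monoid_scheme \<Rightarrow> 'a set \<Rightarrow> 'a set \<Rightarrow> bool" where
  "associates_with L H N \<longleftrightarrow>
    (\<forall>n\<^sub>1 \<in> N. \<forall>n\<^sub>2 \<in> N. \<forall>h\<^sub>1 \<in> H. \<forall>h\<^sub>2 \<in> H.
      (n\<^sub>1 \<otimes>\<^bsub>L\<^esub> h\<^sub>1) \<otimes>\<^bsub>L\<^esub> (n\<^sub>2 \<otimes>\<^bsub>L\<^esub> h\<^sub>2) = n\<^sub>1 \<otimes>\<^bsub>L\<^esub> ((h\<^sub>1 \<otimes>\<^bsub>L\<^esub> n\<^sub>2) \<otimes>\<^bsub>L\<^esub> h\<^sub>2) \<and>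
      n\<^sub>1 \<otimes>\<^bsub>L\<^esub> ((h\<^sub>1 \<otimes>\<^bsub>L\<^esub> n\<^sub>2) \<otimes>\<^bsub>L\<^esub> h\<^sub>2) = n\<^sub>1 \<otimes>\<^bsub>L\<^esub> (h\<^sub>1 \<otimes>\<^bsub>L\<^esub> (n\<^sub>2 \<otimes>\<^bsub>L\<^esub> h\<^sub>2)) \<and>
      n\<^sub>1 \<otimes>\<^bsub>L\<^esub> (h\<^sub>1 \<otimes>\<^bsub>L\<^esub> (n\<^sub>2 \<otimes>\<^bsub>L\<^esub> h\<^sub>2)) = ((n\<^sub>1 \<otimes>\<^bsub>L\<^esub> h\<^sub>1) \<otimes>\<^bsub>L\<^esub> n\<^sub>2) \<otimes>\<^bsub>L\<^esub> h\<^sub>2 \<and>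
      ((n\<^sub>1 \<otimes>\<^bsub>L\<^esub> h\<^sub>1) \<otimes>\<^bsub>L\<^esub> n\<^sub>2) \<otimes>\<^bsub>L\<^esub> h\<^sub>2 = (n\<^sub>1 \<otimes>\<^bsub>L\<^esub> (h\<^sub>1 \<otimes>\<^bsub>L\<^esub> n\<^sub>2)) \<otimes>\<^bsub>L\<^esub> h\<^sub>2) \<and>
    (\<forall>n \<in> N. \<forall>h \<in> H.
      h \<otimes>\<^bsub>L\<^esub> (n \<otimes>\<^bsub>L\<^esub> inv\<^bsub>L\<lparr>carrier := H\<rparr>\<^esub> h) = (h \<otimes>\<^bsub>L\<^esub> n) \<otimes>\<^bsub>L\<^esub> inv\<^bsub>L\<lparr>carrier := H\<rparr>\<^esub> h)"

text \<open>The restriction to \<open>N\<close> is needed because the elements of \<open>BijGroup N\<close> are extensional.\<close>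

definition conj_map :: "('a, 'm) monoid_scheme \<Rightarrow> 'a set \<Rightarrow> 'a set \<Rightarrow> 'a \<Rightarrow> 'a \<Rightarrow> 'a" where
  "conj_map L N H h = (\<lambda>n \<in> N. h \<otimes>\<^bsub>L\<^esub> (n \<otimes>\<^bsub>L\<^esub> inv\<^bsub>L\<lparr>carrier := H\<rparr>\<^esub> h))"

lemma subloop_one:
  assumes "loop L" "S \<subseteq> carrier L" "loop (L\<lparr>carrier := S, one := e\<rparr>)"
  shows "e = \<one>\<^bsub>L\<^esub>"
proof -
  interpret L: loop L by fact
  interpret S: loop "L\<lparr>carrier := S, one := e\<rparr>" by fact
  have e: "e \<in> carrier L" using S.one_closed assms(2) by auto
  have "e \<otimes>\<^bsub>L\<^esub> e = e" using S.l_one[of e] S.one_closed by simp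
  then show ?thesis
    using L.left_solution[OF e e] L.l_one[OF e] L.one_closed e by blast
qed

lemma subloop_loop:
  assumes "loop L" "subloop S L"
  shows "loop (L\<lparr>carrier := S\<rparr>)"
proof -
  obtain e where e: "loop (L\<lparr>carrier := S, one := e\<rparr>)" and S: "S \<subseteq> carrier L"
    using assms(2) unfolding subloop_def by blast
  show ?thesis using e subloop_one[OF assms(1) S e] by simp
qed

lemma loop_subgroup_group:
  assumes "loop L" "loop_subgroup S L"
  shows "group (L\<lparr>carrier := S\<rparr>)"
proof -
  obtain e where e: "group (L\<lparr>carrier := S, one := e\<rparr>)" and S: "S \<subseteq> carrier L"
    using assms(2) unfolding loop_subgroup_def subloop_def by blast
  interpret L: loop L by fact
  interpret S: group "L\<lparr>carrier := S, one := e\<rparr>" by fact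
  have eL: "e \<in> carrier L" using S.one_closed S by auto
  have "e \<otimes>\<^bsub>L\<^esub> e = e" using S.l_one[of e] S.one_closed by simp
  then have "e = \<one>\<^bsub>L\<^esub>"
    using L.left_solution[OF eL eL] L.l_one[OF eL] L.one_closed eL by blast
  with e show ?thesis by simp
qed

lemma SymStab_group:
  assumes "a \<in> A"
  shows "group (SymStab A a)"
proof -
  interpret group_action "BijGroup A" A "\<lambda>f. f"
    unfolding group_action_def group_hom_def group_hom_axioms_def
    by (simp add: group_BijGroup hom_def)
  show ?thesis
    using stabilizer_subgroup[OF assms] group.subgroup_imp_group[OF group_BijGroup]
    unfolding SymStab_def by blast
qed

lemma SymStab_memD:
  assumes "f \<in> carrier (SymStab A a)"
  shows "bij_betw f A A" "f a = a"
  using assms by (auto simp: SymStab_def stabilizer_def BijGroup_def Bij_def)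

lemma semidirect_loop:
  assumes "loop N" "group H" and hom: "\<phi> \<in> hom H (SymStab (carrier N) \<one>\<^bsub>N\<^esub>)"
  shows "loop (semidirect N H \<phi>)"
proof -
  interpret N: loop N by fact
  interpret H: group H by fact
  have bij: "bij_betw (\<phi> h) (carrier N) (carrier N)" and fix1: "\<phi> h \<one>\<^bsub>N\<^esub> = \<one>\<^bsub>N\<^esub>"
    if "h \<in> carrier H" for h
    using SymStab_memD[OF hom_in_carrier[OF hom that]] by simp_all
  have cl: "\<phi> h n \<in> carrier N" if "h \<in> carrier H" "n \<in> carrier N" for h n
    using bij[OF that(1)] that(2) by (auto simp: bij_betw_def)
  have "\<phi> \<one>\<^bsub>H\<^esub> = \<one>\<^bsub>SymStab (carrier N) \<one>\<^bsub>N\<^esub>\<^esub>"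
    using hom_one[OF hom] SymStab_group[OF N.one_closed] H.is_group by blast
  then have id: "\<phi> \<one>\<^bsub>H\<^esub> n = n" if "n \<in> carrier N" for n
    using that by (simp add: SymStab_def BijGroup_def)
  show ?thesis
  proof (unfold_locales, goal_cases)
    case (5 p q)
    obtain a h b g where pq: "p = (a, h)" "q = (b, g)" by fastforce
    have c: "a \<in> carrier N" "h \<in> carrier H" "b \<in> carrier N" "g \<in> carrier H"
      using 5 pq by (auto simp: semidirect_def)
    define k where "k = g \<otimes>\<^bsub>H\<^esub> inv\<^bsub>H\<^esub> h"
    have k: "k \<in> carrier H" "k \<otimes>\<^bsub>H\<^esub> h = g" using c by (auto simp: k_def H.m_assoc)
    have ku: "k' = k" if "k' \<in> carrier H" "k' \<otimes>\<^bsub>H\<^esub> h = g" for k'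
      using H.right_cancel[of h k' k] that k c by simp
    obtain x where x: "x \<in> carrier N" "x \<otimes>\<^bsub>N\<^esub> \<phi> k a = b"
      using N.left_solution[OF cl[OF k(1) c(1)] c(3)] by blast
    have xu: "x' = x" if "x' \<in> carrier N" "x' \<otimes>\<^bsub>N\<^esub> \<phi> k a = b" for x'
      using N.left_solution[OF cl[OF k(1) c(1)] c(3)] that x by blast
    show ?case
    proof (rule ex1I[of _ "(x, k)"], goal_cases)
      case 1
      show ?case using k x c by (simp add: semidirect_def pq)
    next
      case (2 z)
      obtain x' k' where z: "z = (x', k')" by fastforce
      have z': "x' \<in> carrier N" "k' \<in> carrier H" "x' \<otimes>\<^bsub>N\<^esub> \<phi> k' a = b" "k' \<otimes>\<^bsub>H\<^esub> h = g"
        using 2 by (simp_all add: semidirect_def pq z)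
      have "k' = k" using ku z'(2,4) by blast
      moreover from this have "x' = x" using xu z'(1,3) by blast
      ultimately show ?case by (simp add: z)
    qed
  next
    case (6 p q)
    obtain a h b g where pq: "p = (a, h)" "q = (b, g)" by fastforce
    have c: "a \<in> carrier N" "h \<in> carrier H" "b \<in> carrier N" "g \<in> carrier H"
      using 6 pq by (auto simp: semidirect_def)
    define k where "k = inv\<^bsub>H\<^esub> h \<otimes>\<^bsub>H\<^esub> g"
    have k: "k \<in> carrier H" "h \<otimes>\<^bsub>H\<^esub> k = g" using c by (auto simp: k_def H.m_assoc[symmetric])
    have ku: "k' = k" if "k' \<in> carrier H" "h \<otimes>\<^bsub>H\<^esub> k' = g" for k'
      using H.Units_l_cancel[of h k' k] that k c by simp
    obtain y where y: "y \<in> carrier N" "a \<otimes>\<^bsub>N\<^esub> y = b"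
      using N.right_solution[OF c(1,3)] by blast
    have "y \<in> \<phi> h ` carrier N"
      using bij_betw_imp_surj_on[OF bij[OF c(2)]] y(1) by simp
    then obtain x where x: "x \<in> carrier N" "\<phi> h x = y"
      by (elim imageE) simp
    have xu: "x' = x" if "x' \<in> carrier N" "a \<otimes>\<^bsub>N\<^esub> \<phi> h x' = b" for x'
    proof -
      have "\<phi> h x' = \<phi> h x"
        using N.right_solution[OF c(1,3)] y x(2) cl[OF c(2) that(1)] that(2) by blast
      then show ?thesis
        using bij_betw_imp_inj_on[OF bij[OF c(2)]] that(1) x(1) by (simp add: inj_on_eq_iff)
    qed
    show ?case
    proof (rule ex1I[of _ "(x, k)"], goal_cases)
      case 1
      show ?case using k x y c by (simp add: semidirect_def pq)
    next
      case (2 z)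
      obtain x' k' where z: "z = (x', k')" by fastforce
      have z': "x' \<in> carrier N" "k' \<in> carrier H" "a \<otimes>\<^bsub>N\<^esub> \<phi> h x' = b" "h \<otimes>\<^bsub>H\<^esub> k' = g"
        using 2 by (simp_all add: semidirect_def pq z)
      have "k' = k" using ku z'(2,4) by blast
      moreover from this have "x' = x" using xu z'(1,3) by blast
      ultimately show ?case by (simp add: z)
    qed
  qed (auto simp: semidirect_def N.m_closed N.one_closed N.l_one N.r_one cl id fix1)
qed

end

theory Submission
  imports Defs
begin

text \<open>The map \<open>(n, h) \<mapsto> n h\<close> from \<open>N \<times> H\<close> to \<open>N H\<close> is the isomorphism, read backwards.  It is
  injective because \<open>n h = n' h'\<close> gives \<open>n = n' (h' h\<inverse>)\<close>, and as division in the subloop \<open>N\<close> agrees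
  with division in \<open>L\<close>, the element \<open>h' h\<inverse>\<close> of \<open>H\<close> lies in \<open>N \<inter> H = {1}\<close>.

  It is multiplicative once \<open>h n = \<phi>\<^sub>h(n) h\<close> is known (\<open>conj_commute\<close>).  That identity is not immediate
  in a loop, since a factor \<open>h\<inverse> h\<close> need not cancel in \<open>((h n) h\<inverse>) h\<close>.  The way round is that
  \<open>m = \<phi>\<^sub>h(n)\<close> lies in \<open>N\<close>, so that the association hypothesis applies to \<open>m\<close> and gives
  \<open>(m h) h\<inverse> = m = (h n) h\<inverse>\<close>; right cancellation in \<open>L\<close> finishes.  Then
  \<open>(n\<^sub>1 h\<^sub>1)(n\<^sub>2 h\<^sub>2) = n\<^sub>1 ((h\<^sub>1 n\<^sub>2) h\<^sub>2) = n\<^sub>1 ((m h\<^sub>1) h\<^sub>2) = (n\<^sub>1 m)(h\<^sub>1 h\<^sub>2)\<close> with \<open>m = \<phi>\<^bsub>h\<^sub>1\<^esub>(n\<^sub>2)\<close>.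

  That \<open>N H\<close> is a subloop need not be checked by solving equations in it: being a loop is carried
  over from the semidirect product along the multiplicative bijection.\<close>

lemma (in loop) right_cancel:
  assumes "x \<in> carrier L" "y \<in> carrier L" "a \<in> carrier L" "x \<otimes> a = y \<otimes> a"
  shows "x = y"
  using left_solution[OF assms(3) m_closed[OF assms(2,3)]] assms by blast

lemma (in loop) left_cancel:
  assumes "x \<in> carrier L" "y \<in> carrier L" "a \<in> carrier L" "a \<otimes> x = a \<otimes> y"
  shows "x = y"
  using right_solution[OF assms(3) m_closed[OF assms(3,2)]] assms by blast

text \<open>Unique solvability of equations is preserved because an equation in \<open>M\<close> pulls back along the
  bijection \<open>f\<close> to the equation of the same shape in \<open>L\<close>.\<close>

lemma (in loop) loop_transfer:
  fixes M (structure)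
  assumes bij: "bij_betw f (carrier L) (carrier M)"
    and mult: "\<And>x y. \<lbrakk>x \<in> carrier L; y \<in> carrier L\<rbrakk> \<Longrightarrow> f (x \<otimes>\<^bsub>L\<^esub> y) = f x \<otimes>\<^bsub>M\<^esub> f y"
    and one: "f \<one>\<^bsub>L\<^esub> = \<one>\<^bsub>M\<^esub>"
  shows "loop M"
proof -
  have img: "carrier M = f ` carrier L" using bij by (simp add: bij_betw_def)
  have inj: "x = y" if "f x = f y" "x \<in> carrier L" "y \<in> carrier L" for x y
    using bij that by (auto simp: bij_betw_def inj_on_def)
  show ?thesis
  proof (unfold_locales, goal_cases)
    case (5 a b)
    then obtain a' b' where ab: "a = f a'" "b = f b'" "a' \<in> carrier L" "b' \<in> carrier L"
      by (auto simp: img)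
    obtain x where x: "x \<in> carrier L" "x \<otimes>\<^bsub>L\<^esub> a' = b'"
      using left_solution[OF ab(3,4)] by blast
    show ?case
    proof (rule ex1I[of _ "f x"])
      show "f x \<in> carrier M \<and> f x \<otimes>\<^bsub>M\<^esub> a = b"
        using x ab by (simp add: img mult[symmetric])
    next
      fix z assume "z \<in> carrier M \<and> z \<otimes>\<^bsub>M\<^esub> a = b"
      then obtain z' where z: "z = f z'" "z' \<in> carrier L" "f (z' \<otimes>\<^bsub>L\<^esub> a') = f b'"
        using ab by (auto simp: img mult)
      then have "z' \<otimes>\<^bsub>L\<^esub> a' = x \<otimes>\<^bsub>L\<^esub> a'"
        using inj[OF z(3)] ab x m_closed by simp
      then show "z = f x" using right_cancel z x ab by blast
    qed
  next
    case (6 a b)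
    then obtain a' b' where ab: "a = f a'" "b = f b'" "a' \<in> carrier L" "b' \<in> carrier L"
      by (auto simp: img)
    obtain x where x: "x \<in> carrier L" "a' \<otimes>\<^bsub>L\<^esub> x = b'"
      using right_solution[OF ab(3,4)] by blast
    show ?case
    proof (rule ex1I[of _ "f x"])
      show "f x \<in> carrier M \<and> a \<otimes>\<^bsub>M\<^esub> f x = b"
        using x ab by (simp add: img mult[symmetric])
    next
      fix z assume "z \<in> carrier M \<and> a \<otimes>\<^bsub>M\<^esub> z = b"
      then obtain z' where z: "z = f z'" "z' \<in> carrier L" "f (a' \<otimes>\<^bsub>L\<^esub> z') = f b'"
        using ab by (auto simp: img mult)
      then have "a' \<otimes>\<^bsub>L\<^esub> z' = a' \<otimes>\<^bsub>L\<^esub> x"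
        using inj[OF z(3)] ab x m_closed by simp
      then show "z = f x" using left_cancel z x ab by blast
    qed
  qed (auto simp: img mult[symmetric] one[symmetric] m_closed one_closed l_one r_one)
qed

lemma bij_mult_imp_is_iso:
  assumes "loop S" and bij: "bij_betw f (carrier S) (carrier M)"
    and mult: "\<And>x y. \<lbrakk>x \<in> carrier S; y \<in> carrier S\<rbrakk> \<Longrightarrow> f (x \<otimes>\<^bsub>S\<^esub> y) = f x \<otimes>\<^bsub>M\<^esub> f y"
  shows "M \<cong> S"
proof -
  interpret S: loop S by fact
  let ?g = "inv_into (carrier S) f"
  have img: "carrier M = f ` carrier S" and inj: "inj_on f (carrier S)"
    using bij by (simp_all add: bij_betw_def)
  have g: "?g (f x) = x" if "x \<in> carrier S" for x using inv_into_f_f[OF inj that] .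
  have "?g \<in> hom M S"
    by (rule homI) (auto simp: img g mult[symmetric] S.m_closed)
  with bij_betw_inv_into[OF bij] have "?g \<in> iso M S" by (simp add: iso_def)
  then show ?thesis by (auto simp: is_iso_def)
qed

locale associating_pair = loop L for L :: "('a, 'm) monoid_scheme" (structure) +
  fixes N H :: "'a set"
  assumes subloop_N: "subloop N L"
    and subgroup_H: "loop_subgroup H L"
    and disjoint: "N \<inter> H = {\<one>}"
    and assoc: "associates_with L H N"
    and conj_hom: "conj_map L N H \<in> hom (L\<lparr>carrier := H\<rparr>) (SymStab N \<one>)"
begin

sublocale N: loop "L\<lparr>carrier := N\<rparr>"
  rewrites "carrier (L\<lparr>carrier := N\<rparr>) = N" and "\<one>\<^bsub>L\<lparr>carrier := N\<rparr>\<^esub> = \<one>"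
    and "monoid.mult (L\<lparr>carrier := N\<rparr>) = monoid.mult L"
  using subloop_loop[OF loop_axioms subloop_N] by simp_all

sublocale H: group "L\<lparr>carrier := H\<rparr>"
  rewrites "carrier (L\<lparr>carrier := H\<rparr>) = H" and "\<one>\<^bsub>L\<lparr>carrier := H\<rparr>\<^esub> = \<one>"
    and "monoid.mult (L\<lparr>carrier := H\<rparr>) = monoid.mult L"
  using loop_subgroup_group[OF loop_axioms subgroup_H] by simp_all

abbreviation conjug ("\<phi>") where "\<phi> \<equiv> conj_map L N H"

lemma N_carrier: "n \<in> N \<Longrightarrow> n \<in> carrier L"
  using subloop_N by (auto simp: subloop_def)

lemma H_carrier: "h \<in> H \<Longrightarrow> h \<in> carrier L"
  using subgroup_H by (auto simp: loop_subgroup_def subloop_def)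

lemma assoc4:
  assumes "n\<^sub>1 \<in> N" "n\<^sub>2 \<in> N" "h\<^sub>1 \<in> H" "h\<^sub>2 \<in> H"
  shows "(n\<^sub>1 \<otimes> h\<^sub>1) \<otimes> (n\<^sub>2 \<otimes> h\<^sub>2) = n\<^sub>1 \<otimes> ((h\<^sub>1 \<otimes> n\<^sub>2) \<otimes> h\<^sub>2)"
    and "n\<^sub>1 \<otimes> (h\<^sub>1 \<otimes> (n\<^sub>2 \<otimes> h\<^sub>2)) = ((n\<^sub>1 \<otimes> h\<^sub>1) \<otimes> n\<^sub>2) \<otimes> h\<^sub>2"
proof -
  note a = assoc[unfolded associates_with_def, THEN conjunct1, rule_format, OF assms]
  show "(n\<^sub>1 \<otimes> h\<^sub>1) \<otimes> (n\<^sub>2 \<otimes> h\<^sub>2) = n\<^sub>1 \<otimes> ((h\<^sub>1 \<otimes> n\<^sub>2) \<otimes> h\<^sub>2)"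
    using a by (elim conjE)
  show "n\<^sub>1 \<otimes> (h\<^sub>1 \<otimes> (n\<^sub>2 \<otimes> h\<^sub>2)) = ((n\<^sub>1 \<otimes> h\<^sub>1) \<otimes> n\<^sub>2) \<otimes> h\<^sub>2"
    using a by (elim conjE)
qed

text \<open>The two laws for three factors arise from \<open>assoc4\<close> by setting one factor to the identity, which
  belongs to both \<open>N\<close> and \<open>H\<close>.\<close>

lemma assoc_NHH:
  assumes "n \<in> N" "h \<in> H" "k \<in> H"
  shows "(n \<otimes> h) \<otimes> k = n \<otimes> (h \<otimes> k)"
  using assoc4(2)[of n \<one> h k] assms
  by (simp add: l_one r_one m_closed N_carrier H_carrier N.one_closed)

lemma assoc_NNH:
  assumes "n \<in> N" "m \<in> N" "h \<in> H"
  shows "n \<otimes> (m \<otimes> h) = (n \<otimes> m) \<otimes> h"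
  using assoc4(2)[of n m \<one> h] assms
  by (simp add: l_one r_one m_closed N_carrier H_carrier)

lemma conj_closed:
  assumes "h \<in> H" "n \<in> N"
  shows "\<phi> h n \<in> N"
proof -
  have "\<phi> h \<in> carrier (SymStab N \<one>)"
    using hom_in_carrier[OF conj_hom] assms by simp
  from bij_betwE[OF SymStab_memD(1)[OF this]] assms(2) show ?thesis by (rule bspec)
qed

text \<open>The law \<open>(x h) k = x (h k)\<close> is available for \<open>x\<close> in \<open>N\<close>, and \<open>h n\<close> need not lie there.  Hence
  the proof compares both sides after multiplication by \<open>h\<inverse>\<close>, where the right side collapses
  because \<open>\<phi> h n\<close> does lie in \<open>N\<close>.\<close>

lemma conj_commute:
  assumes "h \<in> H" "n \<in> N"
  shows "h \<otimes> n = \<phi> h n \<otimes> h"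
proof -
  let ?i = "inv\<^bsub>L\<lparr>carrier := H\<rparr>\<^esub> h"
  have i: "?i \<in> H" "h \<otimes> ?i = \<one>" using assms(1) by simp_all
  note m = conj_closed[OF assms]
  have "(h \<otimes> n) \<otimes> ?i = \<phi> h n"
    using assoc[unfolded associates_with_def, THEN conjunct2, rule_format, OF assms(2,1)] assms
    by (simp add: conj_map_def)
  also have "\<dots> = (\<phi> h n \<otimes> h) \<otimes> ?i"
    using assoc_NHH[OF m assms(1) i(1)] i m by (simp add: r_one N_carrier)
  finally show ?thesis
    by (rule right_cancel[rotated -1]) (simp_all add: assms m i m_closed N_carrier H_carrier)
qed

lemma product_formula:
  assumes "n\<^sub>1 \<in> N" "n\<^sub>2 \<in> N" "h\<^sub>1 \<in> H" "h\<^sub>2 \<in> H"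
  shows "(n\<^sub>1 \<otimes> h\<^sub>1) \<otimes> (n\<^sub>2 \<otimes> h\<^sub>2) = (n\<^sub>1 \<otimes> \<phi> h\<^sub>1 n\<^sub>2) \<otimes> (h\<^sub>1 \<otimes> h\<^sub>2)"
proof -
  let ?m = "\<phi> h\<^sub>1 n\<^sub>2"
  note m = conj_closed[OF assms(3,2)]
  have "(n\<^sub>1 \<otimes> h\<^sub>1) \<otimes> (n\<^sub>2 \<otimes> h\<^sub>2) = n\<^sub>1 \<otimes> ((?m \<otimes> h\<^sub>1) \<otimes> h\<^sub>2)"
    by (simp only: assoc4(1)[OF assms] conj_commute[OF assms(3,2)])
  also have "\<dots> = n\<^sub>1 \<otimes> (?m \<otimes> (h\<^sub>1 \<otimes> h\<^sub>2))"
    by (simp only: assoc_NHH[OF m assms(3,4)])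
  also have "\<dots> = (n\<^sub>1 \<otimes> ?m) \<otimes> (h\<^sub>1 \<otimes> h\<^sub>2)"
    by (rule assoc_NNH[OF assms(1) m H.m_closed[OF assms(3,4)]])
  finally show ?thesis .
qed

text \<open>This is where \<open>N \<inter> H = {1}\<close> enters: \<open>n\<close> and \<open>n'\<close> differ by a right factor from \<open>H\<close>.\<close>

lemma factorization_unique:
  assumes c: "n \<in> N" "n' \<in> N" "h \<in> H" "h' \<in> H" and eq: "n \<otimes> h = n' \<otimes> h'"
  shows "n = n'" "h = h'"
proof -
  let ?i = "inv\<^bsub>L\<lparr>carrier := H\<rparr>\<^esub> h"
  have i: "?i \<in> H" "h \<otimes> ?i = \<one>" using c(3) by simp_all
  have k: "h' \<otimes> ?i \<in> H" using H.m_closed c(4) i(1) by blast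
  have "n = (n \<otimes> h) \<otimes> ?i" using assoc_NHH[OF c(1,3) i(1)] i c by (simp add: r_one N_carrier)
  also have "\<dots> = n' \<otimes> (h' \<otimes> ?i)" using assoc_NHH[OF c(2,4) i(1)] eq by simp
  finally have n: "n = n' \<otimes> (h' \<otimes> ?i)" .
  \<comment> \<open>Dividing \<open>n\<close> by \<open>n'\<close> inside \<open>N\<close> yields the same quotient, which is therefore in \<open>N \<inter> H\<close>.\<close>
  obtain m where m: "m \<in> N" "n' \<otimes> m = n" using N.right_solution[OF c(2,1)] by blast
  then have "m = h' \<otimes> ?i" using left_cancel[of m "h' \<otimes> ?i" n'] n k c N_carrier H_carrier by simp
  with m(1) k disjoint have "m = \<one>" by blast
  with m(2) c show "n = n'" by (simp add: r_one N_carrier)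
  then show "h = h'" using left_cancel eq c N_carrier H_carrier by blast
qed

lemma semidirect_is_loop: "loop (semidirect (L\<lparr>carrier := N\<rparr>) (L\<lparr>carrier := H\<rparr>) \<phi>)"
  using semidirect_loop[OF N.loop_axioms H.is_group] conj_hom by simp

lemma bij_product:
  "bij_betw (\<lambda>(n, h). n \<otimes> h) (carrier (semidirect (L\<lparr>carrier := N\<rparr>) (L\<lparr>carrier := H\<rparr>) \<phi>))
    (carrier (L\<lparr>carrier := N <#> H\<rparr>))"
  unfolding bij_betw_def inj_on_def
  by (auto simp: semidirect_def set_mult_def dest: factorization_unique)

lemma mult_product:
  assumes "x \<in> carrier (semidirect (L\<lparr>carrier := N\<rparr>) (L\<lparr>carrier := H\<rparr>) \<phi>)"
    and "y \<in> carrier (semidirect (L\<lparr>carrier := N\<rparr>) (L\<lparr>carrier := H\<rparr>) \<phi>)"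
  shows "(\<lambda>(n, h). n \<otimes> h) (x \<otimes>\<^bsub>semidirect (L\<lparr>carrier := N\<rparr>) (L\<lparr>carrier := H\<rparr>) \<phi>\<^esub> y) =
    (\<lambda>(n, h). n \<otimes> h) x \<otimes>\<^bsub>L\<lparr>carrier := N <#> H\<rparr>\<^esub> (\<lambda>(n, h). n \<otimes> h) y"
  using assms by (auto simp: semidirect_def product_formula)

lemma set_mult_subloop: "subloop (N <#> H) L"
proof -
  have "loop (L\<lparr>carrier := N <#> H\<rparr>)"
    using loop.loop_transfer[OF semidirect_is_loop bij_product mult_product]
    by (simp add: semidirect_def l_one one_closed)
  moreover have "N <#> H \<subseteq> carrier L"
    by (auto simp: set_mult_def m_closed N_carrier H_carrier)
  moreover have "N <#> H \<noteq> {}"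
    using disjoint by (auto simp: set_mult_def)
  ultimately show ?thesis
    unfolding subloop_def by (intro conjI exI[of _ \<one>]) simp_all
qed

end

theorem theorem3p2:
  fixes L :: "('a, 'm) monoid_scheme" and N H :: "'a set"
  assumes "loop L"
    and "subloop N L"
    and "loop_subgroup H L"
    and "N \<inter> H = {\<one>\<^bsub>L\<^esub>}"
    and "associates_with L H N"
    and "conj_map L N H \<in> hom (L\<lparr>carrier := H\<rparr>) (SymStab N \<one>\<^bsub>L\<^esub>)"
  shows "subloop (N <#>\<^bsub>L\<^esub> H) L \<and>
    L\<lparr>carrier := N <#>\<^bsub>L\<^esub> H\<rparr> \<cong>
      semidirect (L\<lparr>carrier := N\<rparr>) (L\<lparr>carrier := H\<rparr>) (conj_map L N H)"
proof -
  interpret associating_pair L N H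
    using assms by (simp add: associating_pair_def associating_pair_axioms_def)
  show ?thesis
    using set_mult_subloop bij_mult_imp_is_iso[OF semidirect_is_loop bij_product mult_product]
    by blast
qed

end
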